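(* Let $k\ge 4$ be an integer and let $G$ be a connected $k$-colorable graph of order $n\ge 3$. Then $$\iota^i(G)\le \frac{(k+2)\,n}{2k+6}.$$
   Context: Graphs are finite and simple. For a set $S$ of vertices of $G$, $N[S]$ denotes $S$ together with all neighbors of vertices of $S$. A set $S\subseteq V(G)$ is an isolating set of $G$ if $G-N[S]$ contains no edge. An independent isolating set is an isolating set that is also an independent set. The independent isolation number $\iota^i(G)$ is the minimum size of an independent isolating set of $G$. *)

theory Defs
  imports Complex_Main "HOL-Library.FuncSet" "Graph_Theory.Graph_Theory"
begin

text \<open>
  A finite simple graph is a \<^locale>\<open>graph\<close>: a finite symmetric digraph without loops and
  parallel arcs. Each undirected edge corresponds to two opposite arcs, so having no edge is the
  same as having no arc.
\<close>

definition closed_nbhd :: "('a, 'b) pre_digraph \<Rightarrow> 'a set \<Rightarrow> 'a set" where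
  "closed_nbhd G S = S \<union> {v. \<exists>u\<in>S. u \<rightarrow>\<^bsub>G\<^esub> v}"

definition isolating_set :: "('a, 'b) pre_digraph \<Rightarrow> 'a set \<Rightarrow> bool" where
  "isolating_set G S \<longleftrightarrow>
     S \<subseteq> verts G \<and> arcs (G \<restriction> (verts G - closed_nbhd G S)) = {}"

definition independent_set :: "('a, 'b) pre_digraph \<Rightarrow> 'a set \<Rightarrow> bool" where
  "independent_set G S \<longleftrightarrow> S \<subseteq> verts G \<and> (\<forall>u\<in>S. \<forall>v\<in>S. \<not> u \<rightarrow>\<^bsub>G\<^esub> v)"

definition independent_isolating_set :: "('a, 'b) pre_digraph \<Rightarrow> 'a set \<Rightarrow> bool" where
  "independent_isolating_set G S \<longleftrightarrow> isolating_set G S \<and> independent_set G S"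

definition independent_isolation_number :: "('a, 'b) pre_digraph \<Rightarrow> nat" where
  "independent_isolation_number G = Min (card ` {S. independent_isolating_set G S})"

text \<open>
  At most \<open>k\<close> colors are used; not all of them have to occur.
\<close>

definition k_colorable :: "nat \<Rightarrow> ('a, 'b) pre_digraph \<Rightarrow> bool" where
  "k_colorable k G \<longleftrightarrow>
     (\<exists>c \<in> verts G \<rightarrow> {..<k}. \<forall>u v. u \<rightarrow>\<^bsub>G\<^esub> v \<longrightarrow> c u \<noteq> c v)"

text \<open>
  The minimum ranges over a finite nonempty set: every maximal independent set is isolating.
\<close>

lemma (in graph) finite_independent_isolating_sets:
  "finite {S. independent_isolating_set G S}"
  by (rule finite_subset[of _ "Pow (verts G)"])
    (auto simp: independent_isolating_set_def isolating_set_def)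

lemma (in graph) ex_independent_isolating_set:
  "\<exists>S. independent_isolating_set G S"
proof -
  have "finite {S. independent_set G S}"
    by (rule finite_subset[of _ "Pow (verts G)"]) (auto simp: independent_set_def)
  moreover have "independent_set G {}"
    by (simp add: independent_set_def)
  ultimately obtain S where S: "independent_set G S"
    and max: "\<And>T. independent_set G T \<Longrightarrow> S \<subseteq> T \<Longrightarrow> S = T"
    using finite_has_maximal[of "{S. independent_set G S}"] by auto
  have "v \<in> closed_nbhd G S" if v: "v \<in> verts G" for v
  proof (rule ccontr)
    assume nv: "v \<notin> closed_nbhd G S"
    have "\<not> u \<rightarrow> v \<and> \<not> v \<rightarrow> u" if "u \<in> S" for u
      using nv that arcs_ends_symmetric[OF sym_arcs, of v u] by (auto simp: closed_nbhd_def)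
    moreover have "\<not> v \<rightarrow> v"
      using adj_not_same by blast
    ultimately have "independent_set G (insert v S)"
      using S v by (auto simp: independent_set_def)
    from max[OF this] nv show False
      by (auto simp: closed_nbhd_def)
  qed
  then have "isolating_set G S"
    using S by (auto simp: isolating_set_def independent_set_def)
  with S show ?thesis
    by (auto simp: independent_isolating_set_def)
qed

end

theory Submission
  imports Defs
begin

text \<open>
  Call a vertex outside an independent set \<open>I\<close> settled by \<open>I\<close> if it is dominated by \<open>I\<close> or has only
  dominated neighbours. Once \<open>I\<close> is chosen, no uncovered edge meets a settled vertex, and the edges
  among the remaining vertices can be destroyed greedily at a price of half a vertex per vertex.
  So if \<open>m\<close> is the independent isolation number and \<open>n\<close> the order, then
  \<open>|settled I| - |I| \<le> n - 2 * m\<close> for every independent \<open>I\<close>. Write \<open>r = n - 2 * m\<close>. The theorem is the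
  inequality \<open>2 * m \<le> (k + 2) * r\<close> in disguise, so it is enough to find \<open>k\<close> independent sets for which
  the differences \<open>|settled I| - |I|\<close> add up to at least \<open>2 * m - 2 * r\<close>.
  
  Take an independent isolating set \<open>A\<close> of size \<open>m\<close>. By minimality each \<open>a \<in> A\<close> has a private neighbour
  \<open>p a\<close>, and besides the \<open>m\<close> pairs \<open>(a, p a)\<close> there remains a set \<open>rest\<close> of exactly \<open>r\<close> vertices. Call
  \<open>a\<close> linked if \<open>p a\<close> is adjacent to some other \<open>p b\<close>. The \<open>k\<close> independent sets are the colour classes
  of \<open>rest\<close> together with the vertices \<open>p a\<close>, \<open>a\<close> linked. Counting how many classes settle a given
  vertex, an unlinked pair is settled twice in total. A linked pair costs one because \<open>p a\<close> belongs to
  a class, but it is settled three times, unless all neighbours of \<open>a\<close> in \<open>rest\<close> have the colour of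
  \<open>p a\<close>; such an \<open>a\<close> is called spoiled and may be settled only twice with its partner. Finally each
  vertex of \<open>rest\<close> that has a neighbour in \<open>rest\<close> (an inner vertex) is settled at least once. The sum of
  the differences is therefore at least \<open>2 * m - r + #inner - #spoiled\<close>, where only linked spoiled
  vertices count.
  
  It remains to see that \<open>#spoiled \<le> r + #inner\<close> (lemma \<open>card_spoiled_le\<close>), and this is where the
  minimality of \<open>A\<close> is used a second time. The graph induced on the vertices \<open>p a\<close>, \<open>a\<close> linked, has no
  isolated vertex and so is spanned by vertex-disjoint stars with at least two vertices each. In a star
  one may replace all corresponding vertices \<open>a\<close> by the single vertex \<open>p t\<close> of the centre (lemma
  \<open>exchange\<close>). This saves vertices, hence it must uncover vertices of \<open>rest\<close> whose neighbours in \<open>A\<close>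
  all come from this star. These exposed vertices are different for different stars, and there are
  enough of them to pay for the spoiled vertices of their star (lemma \<open>star_charge\<close>).
\<close>

unbundle no funcset_syntax

section \<open>Star forests\<close>

text \<open>
  The map \<open>h\<close> sends every vertex to the centre of its star. A star assignment with the fewest
  single-vertex stars has none: the vertex \<open>t\<close> of such a star can be attached to a neighbour \<open>u\<close> after
  \<open>u\<close> has been made a centre. If \<open>u\<close> was a leaf of a star with two vertices, its former centre becomes
  a leaf of \<open>u\<close> as well; if it was a leaf of a larger star, that star survives without \<open>u\<close>.
\<close>
lemma star_forest:
  fixes r :: "'a \<Rightarrow> 'a \<Rightarrow> bool"
  assumes fin: "finite S"
    and sym: "\<And>x y. r x y \<Longrightarrow> r y x"
    and irr: "\<And>x. \<not> r x x"
    and nbr: "\<And>v. v \<in> S \<Longrightarrow> \<exists>u\<in>S. r v u"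
  shows "\<exists>h. \<forall>v\<in>S. h v \<in> S \<and> h (h v) = h v \<and> (h v \<noteq> v \<longrightarrow> r (h v) v) \<and>
    (\<exists>u\<in>S. u \<noteq> h v \<and> h u = h v)"
proof -
  define stars where
    "stars h \<longleftrightarrow> (\<forall>v\<in>S. h v \<in> S \<and> h (h v) = h v \<and> (h v \<noteq> v \<longrightarrow> r (h v) v))" for h
  define lone where "lone h = {v \<in> S. \<forall>u\<in>S. h u = v \<longleftrightarrow> u = v}" for h
  have "stars id"
    by (simp add: stars_def)
  then obtain h where h: "stars h" and least: "\<And>g. stars g \<Longrightarrow> card (lone h) \<le> card (lone g)"
    using ex_has_least_nat[of stars id "\<lambda>h. card (lone h)"] by blast
  have "t \<notin> lone h" for t
  proof
    assume t: "t \<in> lone h"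
    then have tS: "t \<in> S" and ht: "\<And>u. u \<in> S \<Longrightarrow> h u = t \<longleftrightarrow> u = t"
      by (auto simp: lone_def)
    obtain u where u: "u \<in> S" "r t u"
      using nbr[OF tS] by blast
    have tu: "t \<noteq> u" "r u t"
      using u irr sym by auto
    have hu: "h u \<in> S" "h (h u) = h u" "h u \<noteq> u \<Longrightarrow> r (h u) u"
      using h u by (auto simp: stars_def)
    \<comment> \<open>The new star with centre \<open>u\<close> absorbs \<open>C\<close>. If \<open>u\<close> already is a centre, then \<open>w = u\<close> and \<open>u\<close> keeps
      its leaves.\<close>
    define w where "w = h u"
    define only_pair where "only_pair \<longleftrightarrow> (\<forall>z\<in>S. h z = w \<longrightarrow> z = u \<or> z = w)"
    define C where "C = {t, u} \<union> (if only_pair then {w} else {})"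
    define g where "g v = (if v \<in> C then u else h v)" for v
    have wS: "w \<in> S" "h w = w" "w \<noteq> t"
      using hu ht[OF u(1)] tu by (auto simp: w_def)
    have C: "t \<in> C" "u \<in> C" "\<And>v. v \<in> C \<Longrightarrow> v = t \<or> v = u \<or> (only_pair \<and> v = w)"
      by (auto simp: C_def split: if_splits)
    have "g v \<in> S \<and> g (g v) = g v \<and> (g v \<noteq> v \<longrightarrow> r (g v) v)" if v: "v \<in> S" for v
    proof (cases "v \<in> C")
      case True
      have "u \<noteq> w \<Longrightarrow> r u w"
        using hu(3) sym by (auto simp: w_def)
      then show ?thesis
        using True C u(1) tu by (auto simp: g_def)
    next
      case False
      have hv: "h v \<in> S" "h (h v) = h v" "h v \<noteq> v \<Longrightarrow> r (h v) v"
        using h v by (auto simp: stars_def)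
      have "h v = u" if "h v \<in> C"
        using C(3)[OF that] ht[OF v] False C v wS only_pair_def C_def by auto
      then have "g (h v) = h v"
        using hv(2) by (auto simp: g_def)
      then show ?thesis
        using False hv by (simp add: g_def)
    qed
    then have g: "stars g"
      by (simp add: stars_def)
    have "x \<in> lone h - {t}" if x: "x \<in> lone g" for x
    proof -
      have xS: "x \<in> S" and gx: "\<And>y. y \<in> S \<Longrightarrow> g y = x \<longleftrightarrow> y = x"
        using x by (auto simp: lone_def)
      have "x \<noteq> u"
        using gx[OF tS] C tu by (auto simp: g_def)
      then have xC: "x \<notin> C"
        using gx[OF xS] by (auto simp: g_def)
      have hx: "h x = x"
        using gx[OF xS] xC by (auto simp: g_def)
      have "y = x" if y: "y \<in> S" "h y = x" for y
      proof (cases "y \<in> C")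
        case True
        have "y \<noteq> t"
          using y ht[OF tS] xC C by auto
        moreover have "y \<noteq> w" if "only_pair"
          using y that wS xC by (auto simp: C_def)
        ultimately have "y = u"
          using C(3)[OF True] by blast
        then have xw: "x = w"
          using y by (simp add: w_def)
        then have "\<not> only_pair"
          using xC by (auto simp: C_def)
        then obtain z where z: "z \<in> S" "h z = w" "z \<noteq> u" "z \<noteq> w"
          by (auto simp: only_pair_def)
        then have "g z = x"
          using xw \<open>\<not> only_pair\<close> ht[OF tS] wS(3) by (auto simp: g_def C_def)
        then show ?thesis
          using gx[OF z(1)] z(4) xw by simp
      next
        case False
        then show ?thesis
          using y gx[OF y(1)] by (simp add: g_def)
      qed
      then show ?thesis
        using xS hx xC C(1) by (auto simp: lone_def)
    qed
    then have less: "lone g \<subseteq> lone h - {t}"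
      by blast
    have "card (lone g) < card (lone h)"
      using less t fin by (intro psubset_card_mono) (auto simp: lone_def)
    with least[OF g] show False
      by simp
  qed
  then have none: "lone h = {}"
    by blast
  have "\<exists>u\<in>S. u \<noteq> h v \<and> h u = h v" if "v \<in> S" for v
    using none that h unfolding lone_def stars_def by blast
  then show ?thesis
    using h unfolding stars_def by blast
qed

section \<open>Independent and isolating sets\<close>

context graph
begin

lemma adj_sym: "u \<rightarrow> v \<Longrightarrow> v \<rightarrow> u"
  using arcs_ends_symmetric[OF sym_arcs] .

lemma in_closed_nbhd_iff: "v \<in> closed_nbhd G S \<longleftrightarrow> v \<in> S \<or> (\<exists>u\<in>S. u \<rightarrow> v)"
  by (auto simp: closed_nbhd_def)

lemma isolating_set_iff:
  "isolating_set G S \<longleftrightarrow>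
     S \<subseteq> verts G \<and> (\<forall>u v. u \<rightarrow> v \<longrightarrow> u \<in> closed_nbhd G S \<or> v \<in> closed_nbhd G S)"
proof -
  have "arcs (G \<restriction> W) = {} \<longleftrightarrow> (\<forall>u v. u \<rightarrow> v \<longrightarrow> u \<notin> W \<or> v \<notin> W)" for W
    by (auto simp: arcs_ends_def arc_to_ends_def)
  then show ?thesis
    unfolding isolating_set_def by (meson DiffI DiffD2 adj_in_verts)
qed

lemma independent_isolation_number_le:
  "independent_isolating_set G S \<Longrightarrow> independent_isolation_number G \<le> card S"
  unfolding independent_isolation_number_def
  using finite_independent_isolating_sets by (intro Min_le) auto

lemma independent_isolation_number_attained:
  "\<exists>S. independent_isolating_set G S \<and> card S = independent_isolation_number G"
proof -
  have "independent_isolation_number G \<in> card ` {S. independent_isolating_set G S}"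
    unfolding independent_isolation_number_def
    using finite_independent_isolating_sets ex_independent_isolating_set by (intro Min_in) auto
  then show ?thesis
    by auto
qed

lemma independent_set_insert:
  assumes "independent_set G S" "v \<in> verts G" "\<And>u. u \<in> S \<Longrightarrow> \<not> v \<rightarrow> u"
  shows "independent_set G (insert v S)"
proof -
  have "\<not> x \<rightarrow> y" if "x \<in> insert v S" "y \<in> insert v S" for x y
    using that assms(1) assms(3)[of x] assms(3)[of y] adj_sym[of x y] adj_not_same
    by (auto simp: independent_set_def)
  moreover have "insert v S \<subseteq> verts G"
    using assms(1,2) by (simp add: independent_set_def)
  ultimately show ?thesis
    by (simp add: independent_set_def)
qed

text \<open>
  Greedy choice: a vertex that still has a neighbour in \<open>W\<close> removes at least two vertices of \<open>W\<close>.
\<close>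

lemma independent_isolating_subset_half:
  assumes "W \<subseteq> verts G"
  shows "\<exists>S\<subseteq>W. independent_set G S \<and> 2 * card S \<le> card W \<and>
    (\<forall>u\<in>W. \<forall>v\<in>W. u \<rightarrow> v \<longrightarrow> u \<in> closed_nbhd G S \<or> v \<in> closed_nbhd G S)"
  using assms
proof (induction "card W" arbitrary: W rule: less_induct)
  case less
  have finW: "finite W"
    using less.prems finite_verts finite_subset by blast
  show ?case
  proof (cases "\<exists>u\<in>W. \<exists>v\<in>W. u \<rightarrow> v")
    case False
    then show ?thesis
      by (intro exI[of _ "{}"]) (auto simp: independent_set_def)
  next
    case True
    then obtain x y where xy: "x \<in> W" "y \<in> W" "x \<rightarrow> y"
      by blast
    define W' where "W' = W - closed_nbhd G {x}"
    have ne: "x \<noteq> y"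
      using xy adj_not_same by blast
    have "W' \<subseteq> W - {x, y}"
      using xy by (auto simp: W'_def in_closed_nbhd_iff)
    then have "card W' \<le> card (W - {x, y})"
      using finW by (intro card_mono) auto
    then have c: "card W' + 2 \<le> card W"
      using xy ne finW card_mono[of W "{x, y}"] by (simp add: card_Diff_subset)
    obtain S where S: "S \<subseteq> W'" "independent_set G S" "2 * card S \<le> card W'"
      "\<And>u v. u \<in> W' \<Longrightarrow> v \<in> W' \<Longrightarrow> u \<rightarrow> v \<Longrightarrow> u \<in> closed_nbhd G S \<or> v \<in> closed_nbhd G S"
    proof -
      have "card W' < card W" "W' \<subseteq> verts G"
        using c less.prems by (auto simp: W'_def)
      from less.hyps[OF this] that show ?thesis
        by blast
    qed
    have "independent_set G (insert x S)"
      using S xy less.prems by (intro independent_set_insert) (auto simp: W'_def in_closed_nbhd_iff)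
    moreover have "2 * card (insert x S) \<le> card W"
      using S(3) c card_insert_le_m1[of "card S + 1" S x] by simp
    moreover have "u \<in> closed_nbhd G (insert x S) \<or> v \<in> closed_nbhd G (insert x S)"
      if "u \<in> W" "v \<in> W" "u \<rightarrow> v" for u v
      using S(4)[of u v] that by (auto simp: W'_def in_closed_nbhd_iff)
    moreover have "insert x S \<subseteq> W"
      using S(1) xy by (auto simp: W'_def)
    ultimately show ?thesis
      by blast
  qed
qed

lemma maximal_independent_subset:
  assumes "W \<subseteq> verts G"
  shows "\<exists>S\<subseteq>W. independent_set G S \<and> W \<subseteq> closed_nbhd G S"
proof -
  have "finite W"
    using assms finite_verts finite_subset by blast
  then have "finite {S. S \<subseteq> W \<and> independent_set G S}"
    by simp
  moreover have "independent_set G {}"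
    by (simp add: independent_set_def)
  then have "{S. S \<subseteq> W \<and> independent_set G S} \<noteq> {}"
    by blast
  ultimately have "\<exists>S\<in>{S. S \<subseteq> W \<and> independent_set G S}.
      \<forall>T\<in>{S. S \<subseteq> W \<and> independent_set G S}. S \<subseteq> T \<longrightarrow> S = T"
    by (rule finite_has_maximal)
  then obtain S where "S \<in> {S. S \<subseteq> W \<and> independent_set G S}"
    and max: "\<forall>T\<in>{S. S \<subseteq> W \<and> independent_set G S}. S \<subseteq> T \<longrightarrow> S = T" ..
  then have S: "S \<subseteq> W" "independent_set G S"
    by simp_all
  have "v \<in> closed_nbhd G S" if v: "v \<in> W" for v
  proof (rule ccontr)
    assume nv: "v \<notin> closed_nbhd G S"
    then have "independent_set G (insert v S)"
      using S v assms adj_sym[of v] by (intro independent_set_insert) (auto simp: in_closed_nbhd_iff)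
    with max S(1) v have "S = insert v S"
      by blast
    with nv show False
      by (auto simp: in_closed_nbhd_iff)
  qed
  with S show ?thesis
    by blast
qed

text \<open>
  No edge at a settled vertex can remain uncovered, whatever is added to \<open>I\<close>, and an independent set
  of unsettled vertices outside \<open>I\<close> can be added to \<open>I\<close> without losing independence.
\<close>
definition settled :: "'a set \<Rightarrow> 'a set" where
  "settled I = {v \<in> verts G - I. v \<in> closed_nbhd G I \<or> (\<forall>u. v \<rightarrow> u \<longrightarrow> u \<in> closed_nbhd G I)}"

lemma isolation_number_settled_bound:
  assumes I: "independent_set G I"
  shows "2 * independent_isolation_number G + card (settled I) \<le> card (verts G) + card I"
proof -
  define W where "W = verts G - I - settled I"
  have IV: "I \<subseteq> verts G"
    using I by (simp add: independent_set_def)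
  have fin: "finite I" "finite (settled I)" "finite W"
    using IV finite_verts finite_subset[OF IV] by (auto simp: settled_def W_def)
  have "verts G = I \<union> settled I \<union> W"
    using IV by (auto simp: W_def settled_def)
  then have "card (verts G) = card (I \<union> settled I \<union> W)"
    by simp
  also have "\<dots> = card I + card (settled I) + card W"
    using fin by (subst card_Un_disjoint; auto simp: W_def settled_def)+
  finally have n: "card (verts G) = card I + card (settled I) + card W" .
  obtain S where S: "S \<subseteq> W" "independent_set G S" "2 * card S \<le> card W"
    "\<And>u v. u \<in> W \<Longrightarrow> v \<in> W \<Longrightarrow> u \<rightarrow> v \<Longrightarrow> u \<in> closed_nbhd G S \<or> v \<in> closed_nbhd G S"
    using independent_isolating_subset_half[of W] unfolding W_def by blast
  have W_far: "v \<notin> closed_nbhd G I" if "v \<in> W" for v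
    using that by (auto simp: W_def settled_def)
  have "\<not> x \<rightarrow> y" if "x \<in> I \<union> S" "y \<in> I \<union> S" for x y
    using that I S(1,2) W_far[of x] W_far[of y] adj_sym[of x y]
    by (auto simp: independent_set_def in_closed_nbhd_iff)
  then have "independent_set G (I \<union> S)"
    using IV S(2) by (simp add: independent_set_def)
  moreover have "u \<in> closed_nbhd G (I \<union> S) \<or> v \<in> closed_nbhd G (I \<union> S)" if uv: "u \<rightarrow> v" for u v
  proof (rule ccontr)
    assume *: "\<not> ?thesis"
    then have "u \<notin> closed_nbhd G I" "v \<notin> closed_nbhd G I"
      by (auto simp: in_closed_nbhd_iff)
    with uv adj_sym[OF uv] have "u \<in> W" "v \<in> W"
      using adj_in_verts[OF uv] by (auto simp: W_def settled_def in_closed_nbhd_iff)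
    with S(4)[of u v] uv * show False
      by (auto simp: in_closed_nbhd_iff)
  qed
  ultimately have "independent_isolating_set G (I \<union> S)"
    by (auto simp: independent_isolating_set_def isolating_set_iff independent_set_def)
  from independent_isolation_number_le[OF this] card_Un_le[of I S] S(3) n
  show ?thesis
    by linarith
qed

text \<open>
  If every neighbour of \<open>a\<close> had another neighbour in \<open>A\<close>, dropping \<open>a\<close> would uncover only \<open>a\<close> itself,
  and all neighbours of \<open>a\<close> would stay covered.
\<close>

lemma minimum_has_private_nbr:
  assumes A: "independent_isolating_set G A"
    and min: "\<And>S. independent_isolating_set G S \<Longrightarrow> card A \<le> card S"
    and a: "a \<in> A"
  shows "\<exists>b. \<forall>u\<in>A. u \<rightarrow> b \<longleftrightarrow> u = a"
proof (rule ccontr)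
  assume no: "\<not> ?thesis"
  have ind: "independent_set G A" and iso: "isolating_set G A"
    using A by (auto simp: independent_isolating_set_def)
  have cover: "v \<in> closed_nbhd G (A - {a})" if v: "v \<in> closed_nbhd G A" "v \<noteq> a" for v
  proof (cases "a \<rightarrow> v")
    case True
    then obtain u where "u \<in> A" "u \<rightarrow> v" "u \<noteq> a"
      using no by blast
    then show ?thesis
      by (auto simp: in_closed_nbhd_iff)
  qed (use v in \<open>auto simp: in_closed_nbhd_iff\<close>)
  have "u \<in> closed_nbhd G (A - {a}) \<or> v \<in> closed_nbhd G (A - {a})" if uv: "u \<rightarrow> v" for u v
  proof (cases "u = a \<or> v = a")
    case True
    with uv adj_sym[OF uv] obtain w where w: "w = u \<or> w = v" "a \<rightarrow> w"
      by blast
    then have "w \<in> closed_nbhd G A" "w \<noteq> a"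
      using a adj_not_same by (auto simp: in_closed_nbhd_iff)
    with w cover show ?thesis
      by blast
  next
    case False
    with uv iso cover show ?thesis
      unfolding isolating_set_iff by blast
  qed
  then have "independent_isolating_set G (A - {a})"
    using ind by (auto simp: independent_isolating_set_def isolating_set_iff independent_set_def)
  from min[OF this] a ind show False
    using finite_verts finite_subset[of A "verts G"]
    by (auto simp: independent_set_def dest: card_Diff1_less)
qed

lemma connected_edge_leaves:
  assumes con: "connected G" and S: "S \<subset> verts G" "S \<noteq> {}"
  shows "\<exists>u\<in>S. \<exists>v. v \<notin> S \<and> u \<rightarrow> v"
proof (rule ccontr)
  assume no: "\<not> ?thesis"
  obtain s w where sw: "s \<in> S" "w \<in> verts G" "w \<notin> S"
    using S by blast
  have "s \<rightarrow>\<^sup>* w"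
    using con sw S reachable_mk_symmetric_eq[OF sym_arcs, of s w]
    by (auto simp: connected_def strongly_connected_def)
  then have "w \<in> S"
    by (induction rule: reachable_induct) (use sw no in auto)
  with sw show False
    by blast
qed

end

section \<open>Exchange arguments in a minimum independent isolating set\<close>

locale matched_minimum = graph +
  fixes A :: "'a set" and p :: "'a \<Rightarrow> 'a"
  assumes indep_isol: "independent_isolating_set G A"
    and minimum: "independent_isolating_set G S \<Longrightarrow> card A \<le> card S"
    and private_nbr: "\<lbrakk>a \<in> A; u \<in> A\<rbrakk> \<Longrightarrow> u \<rightarrow> p a \<longleftrightarrow> u = a"
begin

definition far :: "'a set" where
  "far = verts G - closed_nbhd G A"

definition rest :: "'a set" where
  "rest = verts G - (A \<union> p ` A)"

text \<open>
  The vertices of \<open>rest\<close> whose domination by \<open>A\<close> depends entirely on \<open>F\<close>.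
\<close>
definition exposed :: "'a set \<Rightarrow> 'a set" where
  "exposed F = {x \<in> rest - far. \<forall>a\<in>A. a \<rightarrow> x \<longrightarrow> a \<in> F}"

definition inner :: "'a set" where
  "inner = {x \<in> rest. \<exists>y\<in>rest. x \<rightarrow> y}"

definition linked :: "'a set" where
  "linked = {a \<in> A. \<exists>b\<in>A. p a \<rightarrow> p b}"

text \<open>
  For linked vertices this is the case in which the pair \<open>(a, p a)\<close> may lose one settling: the colour
  class that could settle \<open>a\<close> through \<open>rest\<close> is the one that settles it through \<open>p a\<close> anyway.
\<close>
definition spoiled :: "('a \<Rightarrow> nat) \<Rightarrow> 'a set" where
  "spoiled c = {a \<in> A. \<forall>x\<in>rest. a \<rightarrow> x \<longrightarrow> c x = c (p a)}"

lemma A_subset: "A \<subseteq> verts G"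
  using indep_isol by (simp add: independent_isolating_set_def independent_set_def)

lemma finite_A: "finite A"
  using A_subset finite_verts finite_subset by blast

lemma A_indep: "a \<in> A \<Longrightarrow> b \<in> A \<Longrightarrow> \<not> a \<rightarrow> b"
  using indep_isol by (simp add: independent_isolating_set_def independent_set_def)

lemma adj_p: "a \<in> A \<Longrightarrow> a \<rightarrow> p a" "a \<in> A \<Longrightarrow> p a \<rightarrow> a"
proof -
  show "a \<rightarrow> p a" if "a \<in> A"
    using private_nbr[OF that that] by simp
  then show "p a \<rightarrow> a" if "a \<in> A"
    using that adj_sym by simp
qed

lemma p_verts: "a \<in> A \<Longrightarrow> p a \<in> verts G"
  using adj_p adj_in_verts by blast

lemma p_notin_A: "a \<in> A \<Longrightarrow> p a \<notin> A"
  using adj_p A_indep by blast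

lemma inj_p: "inj_on p A"
proof (rule inj_onI)
  fix a b
  assume "a \<in> A" "b \<in> A" "p a = p b"
  then show "a = b"
    using private_nbr[of b a] adj_p(1)[of a] by simp
qed

lemma finite_rest: "finite rest"
  by (simp add: rest_def)

lemma exposed_subset: "exposed F \<subseteq> rest"
  by (auto simp: exposed_def)

lemma finite_exposed: "finite (exposed F)"
  using exposed_subset finite_rest finite_subset by blast

lemma far_subset_rest: "far \<subseteq> rest"
proof
  fix x
  assume x: "x \<in> far"
  have "x \<noteq> p a" if "a \<in> A" for a
    using x that adj_p(1)[OF that] by (auto simp: far_def in_closed_nbhd_iff)
  then show "x \<in> rest"
    using x by (auto simp: far_def rest_def in_closed_nbhd_iff)
qed

lemma no_adj_A_far: "u \<in> A \<union> far \<Longrightarrow> v \<in> A \<union> far \<Longrightarrow> \<not> u \<rightarrow> v"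
proof
  assume uv: "u \<in> A \<union> far" "v \<in> A \<union> far" "u \<rightarrow> v"
  have "u \<notin> A \<or> v \<notin> A"
    using A_indep uv(3) by blast
  moreover have "u \<in> closed_nbhd G A \<or> v \<in> closed_nbhd G A"
    using indep_isol uv(3) by (simp add: independent_isolating_set_def isolating_set_iff)
  moreover have "u \<in> A \<Longrightarrow> v \<notin> far" "v \<in> A \<Longrightarrow> u \<notin> far"
    using uv(3) adj_sym[OF uv(3)] by (auto simp: far_def in_closed_nbhd_iff)
  ultimately show False
    using uv(1,2) by (auto simp: far_def)
qed

lemma card_verts: "card (verts G) = 2 * card A + card rest"
proof -
  have "verts G = A \<union> p ` A \<union> rest"
    using A_subset p_verts by (auto simp: rest_def)
  then have "card (verts G) = card (A \<union> p ` A \<union> rest)"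
    by simp
  also have "\<dots> = card A + card (p ` A) + card rest"
  proof -
    have "A \<inter> p ` A = {}" "(A \<union> p ` A) \<inter> rest = {}"
      using p_notin_A by (auto simp: rest_def)
    then show ?thesis
      using finite_A finite_rest by (simp add: card_Un_disjoint)
  qed
  finally show ?thesis
    by (simp add: card_image inj_p)
qed

text \<open>
  The set \<open>A - F\<close> together with \<open>p t\<close> and \<open>Y\<close> is independent, because \<open>p t\<close> is private to \<open>t \<in> F\<close> and
  exposed vertices have no neighbour in \<open>A - F\<close>. Being smaller than \<open>A\<close>, it leaves some edge uncovered.
  The private neighbours of \<open>F\<close> are dominated by \<open>p t\<close> and those of \<open>A - F\<close> by their own partner, so
  both ends of that edge lie in \<open>F - {t}\<close>, in \<open>far\<close>, or among the exposed vertices.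
\<close>

lemma exchange:
  assumes F: "F \<subseteq> A" "t \<in> F" "\<And>a. a \<in> F - {t} \<Longrightarrow> p t \<rightarrow> p a"
    and Y: "Y \<subseteq> exposed F" "independent_set G Y" "\<And>y. y \<in> Y \<Longrightarrow> \<not> p t \<rightarrow> y"
    and small: "card Y + 1 < card F"
  obtains u v where "u \<rightarrow> v" "u \<in> (F - {t}) \<union> far \<union> exposed F" "v \<in> (F - {t}) \<union> far \<union> exposed F"
    "u \<notin> closed_nbhd G (insert (p t) Y)" "v \<notin> closed_nbhd G (insert (p t) Y)"
proof -
  define S where "S = (A - F) \<union> insert (p t) Y"
  have finY: "finite Y"
    using Y(1) finite_exposed finite_subset by blast
  have t: "t \<in> A"
    using F by blast
  have "card S \<le> card (A - F) + card (insert (p t) Y)"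
    unfolding S_def by (rule card_Un_le)
  also have "\<dots> \<le> (card A - card F) + (card Y + 1)"
    using F finite_A finite_subset[of F A] finY
    by (intro add_mono) (auto simp: card_Diff_subset card_insert_if)
  also have "\<dots> < card A"
    using small card_mono[OF finite_A F(1)] by linarith
  finally have "\<not> independent_isolating_set G S"
    using minimum[of S] leD by blast
  moreover have "independent_set G S"
  proof -
    have cross: "\<not> u \<rightarrow> y" if "u \<in> A - F" "y \<in> insert (p t) Y" for u y
      using that Y(1) private_nbr[OF t, of u] F(2) by (auto simp: exposed_def)
    have new: "independent_set G (insert (p t) Y)"
      using Y t p_verts by (intro independent_set_insert) auto
    have "\<not> u \<rightarrow> v" if "u \<in> S" "v \<in> S" for u v
      using that cross[of u v] cross[of v u] adj_sym[of u v] A_indep[of u v] new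
      by (auto simp: S_def independent_set_def)
    moreover have "S \<subseteq> verts G"
      using new A_subset by (auto simp: S_def independent_set_def)
    ultimately show ?thesis
      by (simp add: independent_set_def)
  qed
  ultimately obtain u v where uv: "u \<rightarrow> v" "u \<notin> closed_nbhd G S" "v \<notin> closed_nbhd G S"
    by (auto simp: independent_isolating_set_def isolating_set_iff independent_set_def)
  have loc: "w \<in> (F - {t}) \<union> far \<union> exposed F" if w: "w \<in> verts G" "w \<notin> closed_nbhd G S" for w
  proof -
    have nS: "w \<notin> S" "\<And>s. s \<in> S \<Longrightarrow> \<not> s \<rightarrow> w"
      using w by (auto simp: in_closed_nbhd_iff)
    consider "w \<in> A" | a where "a \<in> A" "w = p a" | "w \<in> rest"
      using w by (auto simp: rest_def)
    then show ?thesis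
    proof cases
      case 1
      then show ?thesis
        using nS adj_p(2)[OF t] by (auto simp: S_def)
    next
      case 2
      then have "a \<in> F"
        using nS adj_p(1) by (auto simp: S_def)
      then show ?thesis
        using nS F(3) 2 by (cases "a = t") (auto simp: S_def)
    next
      case 3
      then show ?thesis
        using nS by (auto simp: S_def exposed_def)
    qed
  qed
  show thesis
    using uv loc adj_in_verts[OF uv(1)] by (intro that[of u v]) (auto simp: S_def in_closed_nbhd_iff)
qed

text \<open>
  Choose \<open>Y\<close> as a maximal independent set of exposed vertices not adjacent to \<open>p t\<close>. The vertices that
  remain uncovered then lie in \<open>A \<union> far\<close>, which spans no edge, so \<open>Y\<close> cannot be too small.
\<close>

lemma card_star_le_exposed:
  assumes F: "F \<subseteq> A" "t \<in> F" "\<And>a. a \<in> F - {t} \<Longrightarrow> p t \<rightarrow> p a"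
  shows "card F \<le> card (exposed F) + 1"
proof (rule ccontr)
  assume less: "\<not> ?thesis"
  define W where "W = {x \<in> exposed F. \<not> p t \<rightarrow> x}"
  have "W \<subseteq> verts G"
    using exposed_subset by (auto simp: W_def rest_def)
  then obtain Y where Y: "Y \<subseteq> W" "independent_set G Y" "W \<subseteq> closed_nbhd G Y"
    using maximal_independent_subset by blast
  have "card Y \<le> card (exposed F)"
    using Y(1) finite_exposed by (intro card_mono) (auto simp: W_def)
  then have "card Y + 1 < card F"
    using less by linarith
  then obtain u v where uv: "u \<rightarrow> v"
    "u \<in> (F - {t}) \<union> far \<union> exposed F" "v \<in> (F - {t}) \<union> far \<union> exposed F"
    "u \<notin> closed_nbhd G (insert (p t) Y)" "v \<notin> closed_nbhd G (insert (p t) Y)"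
    using exchange[OF F, of Y] Y(1,2) by (auto simp: W_def)
  have "w \<in> closed_nbhd G (insert (p t) Y)" if "w \<in> exposed F" for w
    using that Y(3) by (auto simp: W_def in_closed_nbhd_iff)
  with uv F(1) have "u \<in> A \<union> far" "v \<in> A \<union> far"
    by blast+
  with no_adj_A_far uv(1) show False
    by blast
qed

text \<open>
  A star with \<open>l\<close> leaves has at least \<open>l\<close> exposed vertices, so only a star with all its \<open>l + 1\<close> vertices
  spoiled and no exposed inner vertex is critical. For such a star, first exchange just one leaf \<open>a\<close>
  and the centre \<open>t\<close> for \<open>p a\<close>: the edge left uncovered must join \<open>t\<close> to an exposed vertex \<open>x\<close>, which
  thus has the colour of \<open>p t\<close>. As \<open>p t\<close> differs in colour from the private neighbours of the leaves,
  and the leaves are spoiled, \<open>x\<close> is adjacent to no leaf. Hence \<open>x\<close> need not be covered when the whole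
  star is exchanged for \<open>p t\<close>, and there must be \<open>l\<close> exposed vertices other than \<open>x\<close>.
\<close>

lemma star_charge:
  assumes F: "F \<subseteq> A" "t \<in> F" "\<And>a. a \<in> F - {t} \<Longrightarrow> p t \<rightarrow> p a" "F \<noteq> {t}"
    and c: "\<And>u v. u \<rightarrow> v \<Longrightarrow> c u \<noteq> c v"
  shows "card (F \<inter> spoiled c) \<le> card (exposed F) + card (exposed F \<inter> inner)"
proof -
  have finF: "finite F"
    using F(1) finite_A finite_subset by blast
  have base: "card F \<le> card (exposed F) + 1"
    using card_star_le_exposed F(1-3) by blast
  have le: "card (F \<inter> spoiled c) \<le> card F"
    using finF by (intro card_mono) auto
  consider "exposed F \<inter> inner \<noteq> {}" | "\<not> F \<subseteq> spoiled c"
    | "exposed F \<inter> inner = {}" "F \<subseteq> spoiled c"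
    by blast
  then show ?thesis
  proof cases
    case 1
    then have "card (exposed F \<inter> inner) \<ge> 1"
      using finite_exposed by (simp add: Suc_le_eq card_gt_0_iff)
    with base le show ?thesis
      by linarith
  next
    case 2
    then have "card (F \<inter> spoiled c) < card F"
      using finF by (intro psubset_card_mono) auto
    with base show ?thesis
      by linarith
  next
    case 3
    have no_rest: "\<not> x \<rightarrow> y" "\<not> y \<rightarrow> x" if "x \<in> exposed F" "y \<in> rest" for x y
    proof -
      show "\<not> x \<rightarrow> y"
        using that 3(1) exposed_subset by (auto simp: inner_def)
      then show "\<not> y \<rightarrow> x"
        using adj_sym[of y x] by blast
    qed
    obtain a where a: "a \<in> F" "a \<noteq> t"
      using F(2,4) by blast
    have pa: "p a \<rightarrow> p t"
      using F(3)[of a] a adj_sym[of "p t" "p a"] by blast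
    have "t \<in> A"
      using F by blast
    have sub: "exposed {t, a} \<subseteq> exposed F"
      using a F(2) by (auto simp: exposed_def)
    have "\<exists>x. x \<in> exposed F \<and> t \<rightarrow> x"
    proof (rule exchange[of "{t, a}" a "{}"])
      show "{t, a} \<subseteq> A"
        using F(1,2) a by blast
      show "p a \<rightarrow> p b" if "b \<in> {t, a} - {a}" for b
        using that pa by blast
      show "card {} + 1 < card {t, a}"
        using a by simp
      show "\<exists>x. x \<in> exposed F \<and> t \<rightarrow> x"
        if uv: "u \<rightarrow> v" "u \<in> {t, a} - {a} \<union> far \<union> exposed {t, a}"
          "v \<in> {t, a} - {a} \<union> far \<union> exposed {t, a}" for u v
      proof -
        have side: "w = t \<or> w \<in> rest" if "w \<in> {t, a} - {a} \<union> far \<union> exposed {t, a}" for w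
          using that far_subset_rest exposed_subset by blast
        have "u \<in> exposed {t, a} \<or> v \<in> exposed {t, a}"
          using uv no_adj_A_far[of u v] \<open>t \<in> A\<close> by blast
        then show ?thesis
        proof
          assume "u \<in> exposed {t, a}"
          then have "u \<in> exposed F" "v = t"
            using sub side[OF uv(3)] no_rest(1)[of u v] uv(1) by blast+
          then show ?thesis
            using adj_sym[OF uv(1)] by blast
        next
          assume "v \<in> exposed {t, a}"
          then have "v \<in> exposed F" "u = t"
            using sub side[OF uv(2)] no_rest(2)[of v u] uv(1) by blast+
          then show ?thesis
            using uv(1) by blast
        qed
      qed
    qed (simp_all add: independent_set_def)
    then obtain x where x: "x \<in> exposed F" "t \<rightarrow> x"
      by blast
    have cx: "c x = c (p t)"
      using x 3(2) F(2) exposed_subset by (auto simp: spoiled_def)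
    \<comment> \<open>Exposed vertices are pairwise non-adjacent here, so no maximal independent subset is needed.\<close>
    define Y where "Y = {y \<in> exposed F - {x}. \<not> p t \<rightarrow> y}"
    have indY: "independent_set G Y"
      using no_rest exposed_subset unfolding independent_set_def Y_def rest_def by blast
    have no_edge: "False" if uv: "u \<rightarrow> v"
      "u \<in> (F - {t}) \<union> far \<union> exposed F" "v \<in> (F - {t}) \<union> far \<union> exposed F"
      "u \<notin> closed_nbhd G (insert (p t) Y)" "v \<notin> closed_nbhd G (insert (p t) Y)" for u v
    proof -
      have only: "w = x" if "w \<in> exposed F" "w \<notin> closed_nbhd G (insert (p t) Y)" for w
        using that by (auto simp: Y_def in_closed_nbhd_iff)
      have nx: "\<not> x \<rightarrow> w" if "w \<in> F - {t}" for w
      proof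
        assume xw: "x \<rightarrow> w"
        have "w \<in> spoiled c" "x \<in> rest"
          using that 3(2) x(1) exposed_subset by blast+
        then have "c x = c (p w)"
          using adj_sym[OF xw] by (simp add: spoiled_def)
        with cx c[OF F(3)[OF that]] show False
          by simp
      qed
      have no_x: "\<not> x \<rightarrow> w" if "w \<in> (F - {t}) \<union> far \<union> exposed F" for w
        using that nx no_rest(1)[OF x(1)] far_subset_rest exposed_subset by blast
      have "u = x \<or> v = x"
        using only[of u] only[of v] uv no_adj_A_far[of u v] F(1) by blast
      with no_x[of u] no_x[of v] uv adj_sym[OF uv(1)] show False
        by blast
    qed
    have "\<not> card Y + 1 < card F"
    proof
      assume less: "card Y + 1 < card F"
      show False
      proof (rule exchange[OF F(1-3) _ indY _ less])
        show "Y \<subseteq> exposed F" "\<And>y. y \<in> Y \<Longrightarrow> \<not> p t \<rightarrow> y"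
          by (auto simp: Y_def)
        show "\<And>a. a \<in> F - {t} \<Longrightarrow> a \<in> F - {t}" .
      qed (rule no_edge)
    qed
    moreover have "card Y \<le> card (exposed F - {x})"
      using finite_exposed by (intro card_mono) (auto simp: Y_def)
    moreover have "card (exposed F - {x}) + 1 = card (exposed F)"
      using x(1) finite_exposed card_Suc_Diff1[of "exposed F" x] by simp
    ultimately show ?thesis
      using le by linarith
  qed
qed

text \<open>
  Every exposed vertex has a neighbour in \<open>A\<close>, which belongs to the star that exposes it; therefore
  different stars expose disjoint sets and the charges of the stars can be added.
\<close>

lemma card_spoiled_le:
  assumes c: "\<And>u v. u \<rightarrow> v \<Longrightarrow> c u \<noteq> c v"
  shows "card (linked \<inter> spoiled c) \<le> card rest + card inner"
proof -
  have finL: "finite linked"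
    using finite_A by (simp add: linked_def)
  have "\<exists>h. \<forall>a\<in>linked. h a \<in> linked \<and> h (h a) = h a \<and> (h a \<noteq> a \<longrightarrow> p (h a) \<rightarrow> p a) \<and>
    (\<exists>b\<in>linked. b \<noteq> h a \<and> h b = h a)"
  proof (rule star_forest[where S = linked and r = "\<lambda>a b. p a \<rightarrow> p b"])
    show "finite linked"
      by (fact finL)
    show "p b \<rightarrow> p a" if "p a \<rightarrow> p b" for a b
      using that by (rule adj_sym)
    show "\<not> p a \<rightarrow> p a" for a
      using adj_not_same by blast
    show "\<exists>b\<in>linked. p a \<rightarrow> p b" if "a \<in> linked" for a
      using that adj_sym[of "p a"] by (auto simp: linked_def)
  qed
  then obtain h where H: "\<forall>a\<in>linked. h a \<in> linked \<and> h (h a) = h a \<and>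
      (h a \<noteq> a \<longrightarrow> p (h a) \<rightarrow> p a) \<and> (\<exists>b\<in>linked. b \<noteq> h a \<and> h b = h a)"
    by (rule exE)
  have h: "h a \<in> linked" "h (h a) = h a" "h a \<noteq> a \<longrightarrow> p (h a) \<rightarrow> p a"
    "\<exists>b\<in>linked. b \<noteq> h a \<and> h b = h a" if "a \<in> linked" for a
    using bspec[OF H that] by simp_all
  define F where "F t = {a \<in> linked. h a = t}" for t
  have charge: "card (F t \<inter> spoiled c) \<le> card (exposed (F t)) + card (exposed (F t) \<inter> inner)"
    if t: "t \<in> h ` linked" for t
  proof (rule star_charge)
    show "F t \<subseteq> A"
      by (auto simp: F_def linked_def)
    obtain a where a: "a \<in> linked" "t = h a"
      using t by blast
    show "t \<in> F t"
      using a h(1,2) by (simp add: F_def)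
    show "F t \<noteq> {t}"
      using a h(4)[OF a(1)] by (auto simp: F_def)
    show "p t \<rightarrow> p a" if "a \<in> F t - {t}" for a
      using that h(3) by (auto simp: F_def)
  qed (fact c)
  have disj: "exposed (F s) \<inter> exposed (F t) = {}" if "s \<noteq> t" for s t
  proof (rule ccontr)
    assume "\<not> ?thesis"
    then obtain x where x: "x \<in> exposed (F s)" "x \<in> exposed (F t)"
      by blast
    then obtain a where "a \<in> A" "a \<rightarrow> x"
      by (auto simp: exposed_def rest_def far_def in_closed_nbhd_iff)
    with x that show False
      by (auto simp: exposed_def F_def)
  qed
  have finF: "finite (F t)" for t
    using finL by (simp add: F_def)
  have "card (\<Union>t\<in>h ` linked. F t \<inter> spoiled c) = (\<Sum>t\<in>h ` linked. card (F t \<inter> spoiled c))"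
  proof (rule card_UN_disjoint)
    show "\<forall>s\<in>h ` linked. \<forall>t\<in>h ` linked. s \<noteq> t \<longrightarrow> (F s \<inter> spoiled c) \<inter> (F t \<inter> spoiled c) = {}"
      by (auto simp: F_def)
  qed (simp_all add: finL finF)
  moreover have "linked \<inter> spoiled c = (\<Union>t\<in>h ` linked. F t \<inter> spoiled c)"
    by (auto simp: F_def)
  ultimately have "card (linked \<inter> spoiled c) = (\<Sum>t\<in>h ` linked. card (F t \<inter> spoiled c))"
    by simp
  also have "\<dots> \<le> (\<Sum>t\<in>h ` linked. card (exposed (F t)) + card (exposed (F t) \<inter> inner))"
    by (intro sum_mono charge)
  also have "\<dots> = (\<Sum>t\<in>h ` linked. card (exposed (F t))) + (\<Sum>t\<in>h ` linked. card (exposed (F t) \<inter> inner))"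
    by (rule sum.distrib)
  also have "(\<Sum>t\<in>h ` linked. card (exposed (F t))) = card (\<Union>t\<in>h ` linked. exposed (F t))"
    by (rule card_UN_disjoint[symmetric]) (simp_all add: finL finite_exposed disj)
  also have "(\<Sum>t\<in>h ` linked. card (exposed (F t) \<inter> inner)) = card (\<Union>t\<in>h ` linked. exposed (F t) \<inter> inner)"
  proof (rule card_UN_disjoint[symmetric])
    show "\<forall>s\<in>h ` linked. \<forall>t\<in>h ` linked. s \<noteq> t \<longrightarrow>
        (exposed (F s) \<inter> inner) \<inter> (exposed (F t) \<inter> inner) = {}"
      using disj by blast
  qed (simp_all add: finL finite_exposed)
  also have "card (\<Union>t\<in>h ` linked. exposed (F t)) + card (\<Union>t\<in>h ` linked. exposed (F t) \<inter> inner)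
      \<le> card rest + card inner"
  proof (rule add_mono)
    show "card (\<Union>t\<in>h ` linked. exposed (F t)) \<le> card rest"
      using exposed_subset by (intro card_mono finite_rest) blast
    have "finite inner"
      using finite_rest by (simp add: inner_def)
    then show "card (\<Union>t\<in>h ` linked. exposed (F t) \<inter> inner) \<le> card inner"
      by (intro card_mono) blast+
  qed
  finally show ?thesis .
qed

end

section \<open>Counting over the colour classes\<close>

locale coloured_matched_minimum = matched_minimum +
  fixes k :: nat and c :: "'a \<Rightarrow> nat"
  assumes proper: "u \<rightarrow> v \<Longrightarrow> c u \<noteq> c v"
    and colours: "v \<in> verts G \<Longrightarrow> c v < k"
    and conn: "connected G"
    and order: "card (verts G) \<ge> 3"
begin

definition core :: "'a set" where
  "core = rest \<union> p ` linked"

definition colour_class :: "nat \<Rightarrow> 'a set" where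
  "colour_class j = {x \<in> core. c x = j}"

definition times_settled :: "'a \<Rightarrow> nat" where
  "times_settled v = card {j \<in> {..<k}. v \<in> settled (colour_class j)}"

lemma core_subset: "core \<subseteq> verts G"
  using p_verts by (auto simp: core_def rest_def linked_def)

lemma A_core_disjoint: "a \<in> A \<Longrightarrow> a \<notin> core"
  using p_notin_A by (auto simp: core_def rest_def linked_def)

lemma p_in_core_iff: "a \<in> A \<Longrightarrow> p a \<in> core \<longleftrightarrow> a \<in> linked"
  using inj_onD[OF inj_p] by (auto simp: core_def rest_def linked_def)

lemma settled_if_adj_core:
  assumes "v \<rightarrow> x" "x \<in> core"
  shows "v \<in> settled (colour_class (c x))"
  using assms proper[OF assms(1)] adj_sym[OF assms(1)] adj_in_verts[OF assms(1)]
  by (auto simp: settled_def colour_class_def in_closed_nbhd_iff)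

lemma settled_if_leaf:
  assumes "v \<in> verts G - core" "\<And>u. v \<rightarrow> u \<Longrightarrow> u \<in> settled (colour_class j)"
    "\<And>u. v \<rightarrow> u \<Longrightarrow> u \<in> closed_nbhd G (colour_class j)"
  shows "v \<in> settled (colour_class j)"
  using assms by (auto simp: settled_def colour_class_def)

lemma times_settled_ge1:
  assumes "v \<in> settled (colour_class j)" "j < k"
  shows "times_settled v \<ge> 1"
proof -
  have "card {j} \<le> times_settled v"
    unfolding times_settled_def using assms by (intro card_mono) auto
  then show ?thesis by simp
qed

lemma times_settled_ge2:
  assumes "v \<in> settled (colour_class i)" "v \<in> settled (colour_class j)" "i < k" "j < k" "i \<noteq> j"
  shows "times_settled v \<ge> 2"
proof -
  have "card {i, j} \<le> times_settled v"
    unfolding times_settled_def using assms by (intro card_mono) auto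
  then show ?thesis using assms by simp
qed

lemma core_colour_less: "x \<in> core \<Longrightarrow> c x < k"
  using colours core_subset by blast

lemma nbr_of_A:
  assumes "a \<in> A" "a \<rightarrow> u"
  shows "u = p a \<or> u \<in> rest"
  using assms A_indep private_nbr adj_in_verts[OF assms(2)] by (auto simp: rest_def)

lemma nbr_of_p:
  assumes "a \<in> A" "p a \<rightarrow> u"
  shows "u = a \<or> u \<in> core"
proof -
  consider "u \<in> A" | b where "b \<in> A" "u = p b" | "u \<in> rest"
    using adj_in_verts[OF assms(2)] by (auto simp: rest_def)
  then show ?thesis
  proof cases
    case 1
    then show ?thesis
      using private_nbr[OF assms(1), of u] adj_sym[OF assms(2)] by simp
  next
    case 2
    then have "b \<in> linked"
      using assms adj_sym[OF assms(2)] by (auto simp: linked_def)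
    then show ?thesis
      using 2 by (simp add: core_def)
  qed (simp add: core_def)
qed

text \<open>
  A linked vertex \<open>p a\<close> is settled by the class of an adjacent \<open>p b\<close>, and \<open>a\<close> by the class of \<open>p a\<close>.
  If \<open>a\<close> is not spoiled, a neighbour in \<open>rest\<close> of another colour settles \<open>a\<close> once more.
  
  An unlinked \<open>p a\<close> is in no class. If one of \<open>a\<close> and \<open>p a\<close> has a neighbour in \<open>rest\<close>, the class of that
  neighbour settles it; the other one is then either settled in the same way or has no neighbour
  besides its partner, and is settled together with it. Connectedness excludes that the pair has no
  neighbour in \<open>rest\<close>, for the order is at least three.
\<close>

lemma pair_count:
  assumes a: "a \<in> A"
  shows "2 + of_bool (a \<in> linked) \<le>
    times_settled a + times_settled (p a) + of_bool (a \<in> linked \<inter> spoiled c)"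
proof (cases "a \<in> linked")
  case True
  then obtain b where b: "b \<in> A" "p a \<rightarrow> p b"
    by (auto simp: linked_def)
  have core: "p a \<in> core" "p b \<in> core"
    using True b a adj_sym[OF b(2)] by (auto simp: core_def linked_def)
  have less: "c (p a) < k" "c (p b) < k"
    using core core_colour_less by blast+
  have A1: "a \<in> settled (colour_class (c (p a)))"
    using settled_if_adj_core[OF adj_p(1)[OF a] core(1)] .
  have P1: "p a \<in> settled (colour_class (c (p b)))"
    using settled_if_adj_core[OF b(2) core(2)] .
  have one: "times_settled a \<ge> 1" "times_settled (p a) \<ge> 1"
    using times_settled_ge1[OF A1] times_settled_ge1[OF P1] less by blast+
  show ?thesis
  proof (cases "a \<in> spoiled c")
    case True
    with one \<open>a \<in> linked\<close> show ?thesis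
      by simp
  next
    case False
    then obtain x where x: "x \<in> rest" "a \<rightarrow> x" "c x \<noteq> c (p a)"
      using a by (auto simp: spoiled_def)
    then have "x \<in> core"
      by (simp add: core_def)
    then have "times_settled a \<ge> 2"
      using times_settled_ge2[OF A1 settled_if_adj_core[OF x(2)]] x(3) less core_colour_less
      by auto
    with one False show ?thesis
      by simp
  qed
next
  case False
  have pa_core: "p a \<notin> core"
    using p_in_core_iff[OF a] False by simp
  have nb: "u = a \<or> u \<in> rest" if "p a \<rightarrow> u" for u
    using nbr_of_p[OF a that] False that a by (auto simp: core_def linked_def)
  have "times_settled a \<ge> 1 \<and> times_settled (p a) \<ge> 1"
  proof (cases "\<exists>x\<in>rest. p a \<rightarrow> x")
    case True
    then obtain x where x: "x \<in> core" "p a \<rightarrow> x"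
      by (auto simp: core_def)
    have P: "p a \<in> settled (colour_class (c x))"
      using settled_if_adj_core[OF x(2,1)] .
    have Pn: "p a \<in> closed_nbhd G (colour_class (c x))"
      using x adj_sym[OF x(2)] by (auto simp: in_closed_nbhd_iff colour_class_def)
    have "\<exists>j<k. a \<in> settled (colour_class j)"
    proof (cases "\<exists>y\<in>rest. a \<rightarrow> y")
      case True
      then obtain y where "y \<in> core" "a \<rightarrow> y"
        by (auto simp: core_def)
      then show ?thesis
        using settled_if_adj_core[of a y] core_colour_less[of y] by blast
    next
      case False
      have only: "u = p a" if "a \<rightarrow> u" for u
        using nbr_of_A[OF a that] False that by blast
      have "a \<in> settled (colour_class (c x))"
      proof (rule settled_if_leaf)
        show "a \<in> verts G - core"
          using a A_subset A_core_disjoint[OF a] by blast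
        show "u \<in> settled (colour_class (c x))" "u \<in> closed_nbhd G (colour_class (c x))" if "a \<rightarrow> u" for u
          using P Pn unfolding only[OF that] .
      qed
      then show ?thesis
        using core_colour_less[OF x(1)] by blast
    qed
    then show ?thesis
      using times_settled_ge1[of a] times_settled_ge1[OF P core_colour_less[OF x(1)]] by blast
  next
    case False
    have "card {a, p a} \<le> 2"
      by (simp add: card_insert_if)
    then have "{a, p a} \<noteq> verts G"
      using order by force
    then have "{a, p a} \<subset> verts G"
      using a A_subset p_verts[OF a] by blast
    then have "\<exists>u\<in>{a, p a}. \<exists>v. v \<notin> {a, p a} \<and> u \<rightarrow> v"
      by (rule connected_edge_leaves[OF conn]) simp
    then obtain u v where uv: "u \<in> {a, p a}" "v \<notin> {a, p a}" "u \<rightarrow> v"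
      by blast
    have "u \<noteq> p a"
      using uv(2,3) nb[of v] False by blast
    then have av: "a \<rightarrow> v"
      using uv(1,3) by blast
    then have "v \<in> rest"
      using nbr_of_A[OF a av] uv(2) by blast
    then have vc: "v \<in> core"
      unfolding core_def by (rule UnI1)
    have S: "a \<in> settled (colour_class (c v))"
      using settled_if_adj_core[OF av vc] .
    have an: "a \<in> closed_nbhd G (colour_class (c v))"
      unfolding in_closed_nbhd_iff colour_class_def using vc adj_sym[OF av] by blast
    have only: "u = a" if "p a \<rightarrow> u" for u
      using nb[OF that] False that by blast
    have P: "p a \<in> settled (colour_class (c v))"
    proof (rule settled_if_leaf)
      show "p a \<in> verts G - core"
        using pa_core p_verts[OF a] by blast
      show "u \<in> settled (colour_class (c v))" "u \<in> closed_nbhd G (colour_class (c v))" if "p a \<rightarrow> u" for u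
        using S an unfolding only[OF that] .
    qed
    show ?thesis
      using times_settled_ge1[OF S core_colour_less[OF vc]]
        times_settled_ge1[OF P core_colour_less[OF vc]] by simp
  qed
  then show ?thesis
    using False by simp
qed

text \<open>
  Sum the numbers of settlings over the pairs \<open>(a, p a)\<close> and over the inner vertices. The inner vertices
  cancel against the ones that pay for spoiled vertices in \<open>card_spoiled_le\<close>.
\<close>

lemma sum_settled_lower:
  "2 * card A + card linked \<le> (\<Sum>j<k. card (settled (colour_class j))) + card rest"
proof -
  define Q where "Q = linked \<inter> spoiled c"
  have sub: "linked \<subseteq> A" "Q \<subseteq> A"
    by (auto simp: linked_def Q_def)
  have "(\<Sum>j<k. card (settled (colour_class j))) =
      (\<Sum>j<k. \<Sum>v\<in>verts G. of_bool (v \<in> settled (colour_class j)))"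
  proof (rule sum.cong)
    fix j
    have "verts G \<inter> settled (colour_class j) = settled (colour_class j)"
      by (auto simp: settled_def)
    then show "card (settled (colour_class j)) =
        (\<Sum>v\<in>verts G. of_bool (v \<in> settled (colour_class j)))"
      by (simp add: sum_of_bool_eq)
  qed simp
  also have "\<dots> = (\<Sum>v\<in>verts G. times_settled v)"
  proof (subst sum.swap, rule sum.cong)
    fix v
    have "{..<k} \<inter> {j. v \<in> settled (colour_class j)} = {j \<in> {..<k}. v \<in> settled (colour_class j)}"
      by blast
    then show "(\<Sum>j<k. of_bool (v \<in> settled (colour_class j))) = times_settled v"
      by (simp add: times_settled_def sum_of_bool_eq)
  qed simp
  finally have swap: "(\<Sum>j<k. card (settled (colour_class j))) = (\<Sum>v\<in>verts G. times_settled v)" .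
  have "(\<Sum>a\<in>A. times_settled a + times_settled (p a)) + (\<Sum>x\<in>inner. times_settled x) =
      (\<Sum>v\<in>A \<union> p ` A \<union> inner. times_settled v)"
  proof -
    have "finite inner" "(A \<union> p ` A) \<inter> inner = {}" "A \<inter> p ` A = {}"
      using finite_rest p_notin_A by (auto simp: inner_def rest_def)
    then show ?thesis
      using finite_A by (simp add: sum.union_disjoint sum.reindex[OF inj_p] sum.distrib)
  qed
  also have "\<dots> \<le> (\<Sum>v\<in>verts G. times_settled v)"
  proof (rule sum_mono2)
    show "A \<union> p ` A \<union> inner \<subseteq> verts G"
      using A_subset p_verts unfolding inner_def rest_def by blast
  qed simp_all
  finally have total: "(\<Sum>a\<in>A. times_settled a + times_settled (p a)) + (\<Sum>x\<in>inner. times_settled x)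
      \<le> (\<Sum>j<k. card (settled (colour_class j)))" unfolding swap .
  have "times_settled x \<ge> 1" if x: "x \<in> inner" for x
  proof -
    obtain y where "y \<in> rest" and xy: "x \<rightarrow> y"
      using x by (auto simp: inner_def)
    then have y: "y \<in> core"
      by (simp add: core_def)
    show ?thesis
      using times_settled_ge1[OF settled_if_adj_core[OF xy y] core_colour_less[OF y]] .
  qed
  then have inner: "card inner \<le> (\<Sum>x\<in>inner. times_settled x)"
    using sum_bounded_below[of inner 1 times_settled] by simp
  have "(\<Sum>a\<in>A. 2 + of_bool (a \<in> linked)) \<le>
      (\<Sum>a\<in>A. times_settled a + times_settled (p a) + of_bool (a \<in> Q))"
    unfolding Q_def by (rule sum_mono) (rule pair_count)
  moreover have "(\<Sum>a\<in>A. of_bool (a \<in> B)) = card B" if "B \<subseteq> A" for B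
    using that finite_A by (simp add: sum_of_bool_eq Int_absorb1)
  ultimately have "2 * card A + card linked \<le>
      (\<Sum>a\<in>A. times_settled a + times_settled (p a)) + card Q"
    using sub by (simp add: sum.distrib mult.commute del: add_2_eq_Suc add_2_eq_Suc')
  moreover have "card Q \<le> card rest + card inner"
    unfolding Q_def by (rule card_spoiled_le) (rule proper)
  ultimately show ?thesis
    using total inner by linarith
qed

text \<open>
  The classes partition \<open>core\<close>, so adding up \<open>isolation_number_settled_bound\<close> over the \<open>k\<close> classes gives
  \<open>2 * m \<le> (k + 2) * |rest|\<close>, where \<open>|rest| = n - 2 * m\<close>.
\<close>

lemma isolation_bound:
  "(2 * k + 6) * independent_isolation_number G \<le> (k + 2) * card (verts G)"
proof -
  define m where "m = independent_isolation_number G"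
  obtain S where "independent_isolating_set G S" "card S = m"
    using independent_isolation_number_attained unfolding m_def by blast
  then have m: "card A = m"
    using minimum[of S] independent_isolation_number_le[OF indep_isol] m_def by simp
  have "2 * m + card (settled (colour_class j)) \<le> card (verts G) + card (colour_class j)" for j
    unfolding m_def using core_subset proper
    by (intro isolation_number_settled_bound) (fastforce simp: independent_set_def colour_class_def)
  then have "(\<Sum>j<k. 2 * m + card (settled (colour_class j))) \<le>
      (\<Sum>j<k. card (verts G) + card (colour_class j))"
    by (intro sum_mono)
  then have sums: "2 * m * k + (\<Sum>j<k. card (settled (colour_class j))) \<le>
      k * card (verts G) + (\<Sum>j<k. card (colour_class j))"
    by (simp add: sum.distrib algebra_simps)
  have fin: "finite core" "finite linked"
    using finite_subset[OF core_subset] finite_A by (simp_all add: linked_def)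
  have "(\<Sum>j<k. card (colour_class j)) = card (\<Union>j<k. colour_class j)"
    using fin by (subst card_UN_disjoint) (auto simp: colour_class_def)
  also have "(\<Union>j<k. colour_class j) = core"
    using core_colour_less by (auto simp: colour_class_def)
  also have "card core \<le> card rest + card linked"
    unfolding core_def using card_Un_le card_image_le[OF fin(2)] by (meson add_left_mono le_trans)
  finally have "2 * m * k + 2 * m \<le> k * card (verts G) + 2 * card rest"
    using sums sum_settled_lower m by linarith
  then show ?thesis
    using card_verts m unfolding m_def by (simp add: algebra_simps)
qed

end

theorem theorem14:
  fixes G :: "('a, 'b) pre_digraph" and k :: nat
  assumes "k \<ge> 4"
    and "graph G"
    and "Digraph_Component.connected G"
    and "k_colorable k G"
    and "card (verts G) \<ge> 3"
  shows "real (independent_isolation_number G)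
           \<le> (real k + 2) * real (card (verts G)) / (2 * real k + 6)"
proof -
  interpret graph G by fact
  obtain A where A: "independent_isolating_set G A" "card A = independent_isolation_number G"
    using independent_isolation_number_attained by blast
  have min: "card A \<le> card S" if "independent_isolating_set G S" for S
    using independent_isolation_number_le[OF that] A(2) by simp
  have "\<forall>a\<in>A. \<exists>b. \<forall>u\<in>A. u \<rightarrow>\<^bsub>G\<^esub> b \<longleftrightarrow> u = a"
    using minimum_has_private_nbr[OF A(1) min] by blast
  then obtain p where p: "\<And>a u. a \<in> A \<Longrightarrow> u \<in> A \<Longrightarrow> u \<rightarrow>\<^bsub>G\<^esub> p a \<longleftrightarrow> u = a"
    by metis
  obtain c where c: "c \<in> Pi (verts G) (\<lambda>_. {..<k})" "\<And>u v. u \<rightarrow>\<^bsub>G\<^esub> v \<Longrightarrow> c u \<noteq> c v"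
    using assms(4) by (auto simp: k_colorable_def)
  interpret coloured_matched_minimum G A p k c
    by unfold_locales (use A(1) min p c assms in auto)
  have "real ((2 * k + 6) * independent_isolation_number G) \<le> real ((k + 2) * card (verts G))"
    using isolation_bound by (simp only: of_nat_le_iff)
  then show ?thesis
    by (simp add: field_simps)
qed

end
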